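(* Let $k_\mathcal{G}=n_\mathcal{G}\ge1$ and $k_\mathcal{H}=n_\mathcal{H}-3\ge1$, and write $n=n_\mathcal{H}$. For $g\in V(\mathcal{G})$ let $s_g=\sum_{i=0}^{3}\alpha_i\sigma_i(g)$, where $\alpha_0=-\tfrac16 n^3(\sqrt3+3\sqrt2+3)+\tfrac12 n^2(2\sqrt3+5\sqrt2+4)-\tfrac12 n(\tfrac{11}{3}\sqrt3+6\sqrt2+3)+\sqrt3$, $\alpha_1=\tfrac12 n^2(\sqrt3+3\sqrt2+3)-\tfrac12 n(5\sqrt3+13\sqrt2+11)+3(\sqrt3+2\sqrt2)+4$, $\alpha_2=-n(\sqrt3+3\sqrt2+3)+3\sqrt3+8\sqrt2+7$, $\alpha_3=\sqrt3+3\sqrt2+3$. Then these polynomials form a $3$-sum-of-squares certificate of $f_{\mathrm{viz}}$, i.e. $f_{\mathrm{viz}}\equiv\sum_{g\in V(\mathcal{G})}s_g^2\pmod{I_{\mathrm{viz}}}$; consequently $\gamma(G)\gamma(H)\le\gamma(G\Box H)$ for all graphs $G$ on $n_\mathcal{G}$ vertices with domination number $n_\mathcal{G}$ and $H$ on $n_\mathcal{H}$ vertices with domination number $n_\mathcal{H}-3$.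
   Context: $\mathbb{K}$ is a subfield of $\mathbb{R}$ containing $\sqrt2,\sqrt3$ (e.g. $\mathbb{K}=\mathbb{R}$). $V(\mathcal{G})$ is a set of $n_\mathcal{G}$ vertices with fixed subset $D_\mathcal{G}$ of size $k_\mathcal{G}$; $V(\mathcal{H})$ a disjoint set of $n_\mathcal{H}$ vertices with fixed subset $D_\mathcal{H}$ of size $k_\mathcal{H}$. Variables $e_{gg'}=e_{g'g}$ for 2-subsets of $V(\mathcal{G})$, $e_{hh'}$ for 2-subsets of $V(\mathcal{H})$, $x_{gh}$ for $g\in V(\mathcal{G}),h\in V(\mathcal{H})$; $P$ is the polynomial ring over $\mathbb{K}$ in these. $I_{\mathrm{viz}}\subseteq P$ is generated by: $e_{gg'}^2-e_{gg'}$; $\prod_{g'\in D_\mathcal{G}}(1-e_{gg'})$ for $g\in V(\mathcal{G})\setminus D_\mathcal{G}$; $\prod_{g'\in V(\mathcal{G})\setminus S}\sum_{g\in S}e_{gg'}$ for $S\subseteq V(\mathcal{G})$, $|S|=k_\mathcal{G}-1$; the same three families for $\mathcal{H}$; $x_{gh}^2-x_{gh}$; and $(1-x_{gh})\prod_{g'\ne g}(1-e_{gg'}x_{g'h})\prod_{h'\ne h}(1-e_{hh'}x_{gh'})$ for all $g,h$. $f_{\mathrm{viz}}=\sum_{g,h}x_{gh}-k_\mathcal{G}k_\mathcal{H}$. For $g\in V(\mathcal{G})$ and integer $i\ge0$, $\sigma_i(g)=\sum_{S\subseteq V(\mathcal{H}),|S|=i}\prod_{h\in S}x_{gh}$ ($\sigma_0(g)=1$).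 $\gamma(\cdot)$ is the domination number, $G\Box H$ the Cartesian product graph. An $\ell$-sum-of-squares certificate of $f$ modulo $I$ is a family of polynomials of degree $\le\ell$ whose sum of squares is congruent to $f$ modulo $I$. *)

theory Defs
  imports
    Complex_Main
    "HOL-Library.Poly_Mapping"
    "HOL-Algebra.Subrings"
    "HOL-Algebra.Ideal"
    "HOL-Algebra.Algebraic_Closure_Type"
    "Graph_Theory.Pair_Digraph"
begin

section \<open>Multivariate polynomials over a subfield of the reals\<close>

text \<open>
  A polynomial maps monomials (exponent vectors \<open>'v \<Rightarrow>\<^sub>0 nat\<close>) to real coefficients, so the
  ring operations are those of \<open>Poly_Mapping\<close>. A subfield of the reals is a set \<open>K\<close> with
  \<open>subfield K ring_of_type_algebra\<close>.
\<close>

type_synonym 'v rpoly = "('v \<Rightarrow>\<^sub>0 nat) \<Rightarrow>\<^sub>0 real"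

definition pvar :: "'v \<Rightarrow> 'v rpoly" where
  "pvar v = Poly_Mapping.single (Poly_Mapping.single v 1) 1"

definition pconst :: "real \<Rightarrow> 'v rpoly" where
  "pconst c = Poly_Mapping.single 0 c"

text \<open>The degree of the zero polynomial is 0 here; only upper bounds on degrees are used.\<close>

definition total_degree :: "'v rpoly \<Rightarrow> nat" where
  "total_degree p =
     Max (insert 0 ((\<lambda>m. \<Sum>v\<in>Poly_Mapping.keys m. Poly_Mapping.lookup m v) ` Poly_Mapping.keys p))"

definition poly_ring_over :: "real set \<Rightarrow> 'v set \<Rightarrow> 'v rpoly ring" where
  "poly_ring_over K vs =
     ring_of_type_algebra
       \<lparr>carrier := {p. (\<forall>m. Poly_Mapping.lookup p m \<in> K) \<and>
                      (\<forall>m\<in>Poly_Mapping.keys p. Poly_Mapping.keys m \<subseteq> vs)}\<rparr>"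

text \<open>
  \<open>sos_certificate R I l f A s\<close>: the polynomials \<open>s a\<close>, \<open>a \<in> A\<close>, of the polynomial ring \<open>R\<close> form an
  \<open>l\<close>-sum-of-squares certificate of \<open>f\<close> modulo the ideal \<open>I\<close>.
\<close>

definition sos_certificate ::
  "'v rpoly ring \<Rightarrow> 'v rpoly set \<Rightarrow> nat \<Rightarrow> 'v rpoly \<Rightarrow> 'a set \<Rightarrow> ('a \<Rightarrow> 'v rpoly) \<Rightarrow> bool" where
  "sos_certificate R I l f A s \<longleftrightarrow>
     finite A \<and>
     (\<forall>a\<in>A. s a \<in> carrier R \<and> total_degree (s a) \<le> l) \<and>
     f - (\<Sum>a\<in>A. (s a)\<^sup>2) \<in> I"


section \<open>The Vizing ideal\<close>

text \<open>
  Edge variables are indexed by 2-element vertex sets, so \<open>e\<close>-variables are symmetric in their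
  two vertices. The constructors keep the variables of the two graphs apart.
\<close>

datatype ('g, 'h) viz_var = VEG "'g set" | VEH "'h set" | VX 'g 'h

definition viz_vars :: "'g set \<Rightarrow> 'h set \<Rightarrow> ('g, 'h) viz_var set" where
  "viz_vars VG VH =
     VEG ` {p. p \<subseteq> VG \<and> card p = 2} \<union> VEH ` {p. p \<subseteq> VH \<and> card p = 2} \<union>
     {VX g h | g h. g \<in> VG \<and> h \<in> VH}"

definition viz_ring :: "real set \<Rightarrow> 'g set \<Rightarrow> 'h set \<Rightarrow> ('g, 'h) viz_var rpoly ring" where
  "viz_ring K VG VH = poly_ring_over K (viz_vars VG VH)"

text \<open>
  The generators for a graph on \<open>V\<close> in which \<open>D\<close> is a minimum dominating set; \<open>e {v, w}\<close> is the edge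
  variable of the pair \<open>v\<close>, \<open>w\<close>.
\<close>

definition graph_gens :: "('v set \<Rightarrow> 'x rpoly) \<Rightarrow> 'v set \<Rightarrow> 'v set \<Rightarrow> 'x rpoly set" where
  "graph_gens e V D =
     {(e {v, w})\<^sup>2 - e {v, w} | v w. v \<in> V \<and> w \<in> V \<and> v \<noteq> w} \<union>
     {\<Prod>w\<in>D. 1 - e {v, w} | v. v \<in> V - D} \<union>
     {\<Prod>w\<in>V - S. \<Sum>v\<in>S. e {v, w} | S. S \<subseteq> V \<and> card S + 1 = card D}"

definition product_gens :: "'g set \<Rightarrow> 'h set \<Rightarrow> ('g, 'h) viz_var rpoly set" where
  "product_gens VG VH =
     {(pvar (VX g h))\<^sup>2 - pvar (VX g h) | g h. g \<in> VG \<and> h \<in> VH} \<union>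
     {(1 - pvar (VX g h)) *
      (\<Prod>g'\<in>VG - {g}. 1 - pvar (VEG {g, g'}) * pvar (VX g' h)) *
      (\<Prod>h'\<in>VH - {h}. 1 - pvar (VEH {h, h'}) * pvar (VX g h')) | g h. g \<in> VG \<and> h \<in> VH}"

definition viz_gens ::
  "'g set \<Rightarrow> 'g set \<Rightarrow> 'h set \<Rightarrow> 'h set \<Rightarrow> ('g, 'h) viz_var rpoly set" where
  "viz_gens VG DG VH DH =
     graph_gens (\<lambda>p. pvar (VEG p)) VG DG \<union> graph_gens (\<lambda>p. pvar (VEH p)) VH DH \<union>
     product_gens VG VH"

definition viz_ideal ::
  "real set \<Rightarrow> 'g set \<Rightarrow> 'g set \<Rightarrow> 'h set \<Rightarrow> 'h set \<Rightarrow> ('g, 'h) viz_var rpoly set" where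
  "viz_ideal K VG DG VH DH = Idl\<^bsub>viz_ring K VG VH\<^esub> (viz_gens VG DG VH DH)"

definition f_viz ::
  "'g set \<Rightarrow> 'g set \<Rightarrow> 'h set \<Rightarrow> 'h set \<Rightarrow> ('g, 'h) viz_var rpoly" where
  "f_viz VG DG VH DH =
     (\<Sum>g\<in>VG. \<Sum>h\<in>VH. pvar (VX g h)) - pconst (real (card DG * card DH))"

definition sigma :: "'h set \<Rightarrow> nat \<Rightarrow> 'g \<Rightarrow> ('g, 'h) viz_var rpoly" where
  "sigma VH i g = (\<Sum>S | S \<subseteq> VH \<and> card S = i. \<Prod>h\<in>S. pvar (VX g h))"


section \<open>The coefficients of the certificate\<close>

definition alpha0 :: "real \<Rightarrow> real" where
  "alpha0 n =
     - (1/6) * n^3 * (sqrt 3 + 3 * sqrt 2 + 3)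
     + 1/2 * n^2 * (2 * sqrt 3 + 5 * sqrt 2 + 4)
     - 1/2 * n * (11/3 * sqrt 3 + 6 * sqrt 2 + 3) + sqrt 3"

definition alpha1 :: "real \<Rightarrow> real" where
  "alpha1 n =
     1/2 * n^2 * (sqrt 3 + 3 * sqrt 2 + 3)
     - 1/2 * n * (5 * sqrt 3 + 13 * sqrt 2 + 11) + 3 * (sqrt 3 + 2 * sqrt 2) + 4"

definition alpha2 :: "real \<Rightarrow> real" where
  "alpha2 n = - n * (sqrt 3 + 3 * sqrt 2 + 3) + 3 * sqrt 3 + 8 * sqrt 2 + 7"

definition alpha3 :: real where
  "alpha3 = sqrt 3 + 3 * sqrt 2 + 3"

definition s_viz :: "'h set \<Rightarrow> 'g \<Rightarrow> ('g, 'h) viz_var rpoly" where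
  "s_viz VH g =
     (let n = real (card VH) in
       pconst (alpha0 n) * sigma VH 0 g + pconst (alpha1 n) * sigma VH 1 g +
       pconst (alpha2 n) * sigma VH 2 g + pconst alpha3 * sigma VH 3 g)"


section \<open>Domination in graphs\<close>

text \<open>
  Finite simple graphs are those satisfying \<open>pair_graph\<close>: an edge is represented by its two
  opposite arcs.
\<close>

definition dominating_set :: "'a pair_pre_digraph \<Rightarrow> 'a set \<Rightarrow> bool" where
  "dominating_set G D \<longleftrightarrow>
     D \<subseteq> pverts G \<and> (\<forall>v\<in>pverts G - D. \<exists>u\<in>D. (u, v) \<in> parcs G)"

definition domination_number :: "'a pair_pre_digraph \<Rightarrow> nat" where
  "domination_number G = Min (card ` {D. dominating_set G D})"

definition cartesian_product ::
  "'a pair_pre_digraph \<Rightarrow> 'b pair_pre_digraph \<Rightarrow> ('a \<times> 'b) pair_pre_digraph" where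
  "cartesian_product G H =
     \<lparr>pverts = pverts G \<times> pverts H,
      parcs = {((g, h), (g', h')) | g h g' h'.
                 g = g' \<and> g \<in> pverts G \<and> (h, h') \<in> parcs H \<or>
                 h = h' \<and> h \<in> pverts H \<and> (g, g') \<in> parcs G}\<rparr>"

end

theory Submission
  imports Defs
begin

text \<open>
  The ideal contains \<open>v\<^sup>2 - v\<close> for every variable \<open>v\<close>. Passing repeatedly to the colon ideals by
  \<open>v\<close> and by \<open>v - 1\<close>, membership in it reduces to membership in ideals modulo which every variable
  is 0 or 1, that is, to evaluation at the Boolean zeros of the generators. At such a zero
  all edges of \<open>G\<close> are absent, so every row \<open>{h. x\<^sub>g\<^sub>h = 1}\<close> dominates \<open>H\<close> and has
  \<open>m \<in> {n - 3, \<dots>, n}\<close> elements. The \<open>\<alpha>\<^sub>i\<close> are the coefficients for which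
  \<open>\<Sum>i\<le>3. \<alpha>\<^sub>i (m choose i)\<close> takes the values \<open>0, 1, -\<surd>2, \<surd>3\<close> there, whose squares are
  \<open>m - (n - 3)\<close>; summing over the rows gives \<open>f\<close>.

  For the inequality between the domination numbers, a graph with \<open>\<gamma>(G) = n\<^sub>G\<close> has no edges, so each
  of the \<open>n\<^sub>G\<close> slices of a dominating set of the product dominates \<open>H\<close>.
\<close>

section \<open>Ideals containing Boolean equations\<close>

text \<open>\<open>J\<close> is an ideal of a subring \<open>A\<close>, both taken as sets inside a
  type-class ring, so that polynomial arithmetic uses the ordinary \<open>+\<close> and
  \<open>*\<close>. The subring is kept explicit because coefficients are restricted to
  \<open>K\<close>.\<close>

locale subring_ideal =
  fixes A J :: "'r::comm_ring_1 set"
  assumes subset: "J \<subseteq> A"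
    and one_A: "1 \<in> A"
    and uminus_A: "a \<in> A \<Longrightarrow> - a \<in> A"
    and add_A: "a \<in> A \<Longrightarrow> b \<in> A \<Longrightarrow> a + b \<in> A"
    and mult_A: "a \<in> A \<Longrightarrow> b \<in> A \<Longrightarrow> a * b \<in> A"
    and zero: "0 \<in> J"
    and add: "a \<in> J \<Longrightarrow> b \<in> J \<Longrightarrow> a + b \<in> J"
    and mult: "a \<in> A \<Longrightarrow> b \<in> J \<Longrightarrow> a * b \<in> J"
begin

lemma uminus: "a \<in> J \<Longrightarrow> - a \<in> J"
  using mult[of "-1" a] one_A uminus_A by simp

lemma diff: "a \<in> J \<Longrightarrow> b \<in> J \<Longrightarrow> a - b \<in> J"
  using add[of a "- b"] uminus by simp

lemma diff_A: "a \<in> A \<Longrightarrow> b \<in> A \<Longrightarrow> a - b \<in> A"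
  using add_A[of a "- b"] uminus_A by simp

lemma sum_A: "(\<And>i. i \<in> I \<Longrightarrow> f i \<in> A) \<Longrightarrow> sum f I \<in> A"
  \<comment> \<open>A sum over an infinite index set defaults to 0, which lies in
    \<open>A\<close>.\<close>
  using zero subset by (induction I rule: infinite_finite_induct) (auto intro: add_A)

lemma prod_A: "(\<And>i. i \<in> I \<Longrightarrow> f i \<in> A) \<Longrightarrow> prod f I \<in> A"
  by (induction I rule: infinite_finite_induct) (auto intro: mult_A one_A)

lemma colon:
  assumes "a \<in> A"
  shows "subring_ideal A {x \<in> A. a * x \<in> J}"
proof
  show "b * c \<in> {x \<in> A. a * x \<in> J}" if "b \<in> A" "c \<in> {x \<in> A. a * x \<in> J}" for b c
    using that mult[of b "a * c"] mult_A by (simp add: mult.left_commute)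
qed (use zero subset one_A in \<open>auto intro: uminus_A add_A mult_A add simp: distrib_left\<close>)

lemma subset_colon: "a \<in> A \<Longrightarrow> J \<subseteq> {x \<in> A. a * x \<in> J}"
  using subset mult by auto

end

text \<open>Since \<open>e * (e - 1)\<close> is in \<open>J\<close>, the colon ideal by
  \<open>e\<close> contains \<open>e - 1\<close> and the one by \<open>e - 1\<close> contains
  \<open>e\<close>. If \<open>f\<close> lies in both, then \<open>e * f\<close> and
  \<open>(e - 1) * f\<close> are in \<open>J\<close>, and their difference is \<open>f\<close>.
  Induction decides the elements of \<open>E\<close> one at a time.\<close>

lemma boolean_ideal_memberI:
  fixes A J :: "'r::comm_ring_1 set"
  assumes "finite E" and "subring_ideal A J" and "E \<subseteq> A" and "\<And>e. e \<in> E \<Longrightarrow> e\<^sup>2 - e \<in> J"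
    and "f \<in> A"
    and "\<And>J'. subring_ideal A J' \<Longrightarrow> J \<subseteq> J' \<Longrightarrow> (\<And>e. e \<in> E \<Longrightarrow> e \<in> J' \<or> e - 1 \<in> J') \<Longrightarrow> f \<in> J'"
  shows "f \<in> J"
  using assms
proof (induction E arbitrary: J rule: finite_induct)
  case empty
  then show ?case by blast
next
  case (insert e E)
  interpret subring_ideal A J by fact
  have e: "e \<in> A" "e - 1 \<in> A" "e\<^sup>2 - e \<in> J"
    using insert.prems one_A by (auto intro: diff_A)
  \<comment> \<open>The induction hypothesis is applied to the colon ideal. Any larger ideal
    inherits the decision \<open>ea\<close> about \<open>e\<close>.\<close>
  have split: "f \<in> {x \<in> A. a * x \<in> J}"
    if a: "a \<in> A" and ea: "e \<in> {x \<in> A. a * x \<in> J} \<or> e - 1 \<in> {x \<in> A. a * x \<in> J}" for a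
  proof (rule insert.IH[OF colon[OF a]])
    show "E \<subseteq> A" "f \<in> A"
      using insert.prems by auto
    show "e'\<^sup>2 - e' \<in> {x \<in> A. a * x \<in> J}" if "e' \<in> E" for e'
      using insert.prems(3)[of e'] that subset_colon[OF a] by blast
    show "f \<in> J'" if "subring_ideal A J'" "{x \<in> A. a * x \<in> J} \<subseteq> J'"
      "\<And>e. e \<in> E \<Longrightarrow> e \<in> J' \<or> e - 1 \<in> J'" for J'
      using insert.prems(5)[OF that(1)] that(2,3) subset_colon[OF a] ea by blast
  qed
  have "e * f \<in> J" "(e - 1) * f \<in> J"
    using split[of e] split[of "e - 1"] e by (auto simp: algebra_simps power2_eq_square)
  from diff[OF this] show ?case
    by (simp add: algebra_simps)
qed

section \<open>Polynomials over a subfield of the reals\<close>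

lemma pconst_add: "pconst (a + b) = pconst a + pconst b"
  by (simp add: pconst_def single_add)

lemma pconst_mult: "pconst (a * b) = pconst a * pconst b"
  by (simp add: pconst_def mult_single)

lemma pconst_0 [simp]: "pconst 0 = 0" and pconst_1 [simp]: "pconst 1 = 1"
  by (simp_all add: pconst_def)

lemma pconst_uminus: "pconst (- a) = - pconst a"
  by (simp add: pconst_def single_uminus)

lemma pconst_diff: "pconst (a - b) = pconst a - pconst b"
  using pconst_add[of a "- b"] by (simp add: pconst_uminus)

text \<open>Coefficients of a product of polynomials are given by \<open>Sum_any\<close>; this keeps
  them in \<open>K\<close>.\<close>

lemma Sum_any_closed:
  assumes "0 \<in> K" "\<And>a b. a \<in> K \<Longrightarrow> b \<in> K \<Longrightarrow> a + b \<in> K" "\<And>a. f a \<in> K"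
  shows "Sum_any f \<in> K"
proof -
  have "sum f S \<in> K" for S
    using assms by (induction S rule: infinite_finite_induct) auto
  then show ?thesis
    by (simp add: Sum_any.expand_set)
qed

locale real_subfield =
  fixes K :: "real set"
  assumes subfield: "subfield K (ring_of_type_algebra :: real ring)"
begin

text \<open>Translates the record operations of \<open>subfield\<close> into type-class arithmetic.
  Negatives and inverses are identified by uniqueness, the inverse being extracted from the units of
  the ring restricted to \<open>K\<close>.\<close>

lemma
  shows K_0: "0 \<in> K" and K_1: "1 \<in> K"
    and K_add: "a \<in> K \<Longrightarrow> b \<in> K \<Longrightarrow> a + b \<in> K"
    and K_mult: "a \<in> K \<Longrightarrow> b \<in> K \<Longrightarrow> a * b \<in> K"
    and K_uminus: "a \<in> K \<Longrightarrow> - a \<in> K"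
    and K_inverse: "a \<in> K \<Longrightarrow> inverse a \<in> K"
proof -
  let ?R = "ring_of_type_algebra :: real ring"
  interpret R: field ?R
    by (rule field_from_type_algebra)
  interpret K: subfield K ?R
    by (rule subfield)
  note R_def = ring_of_type_algebra_def
  show K0: "0 \<in> K" and "1 \<in> K" and add: "\<And>a b. a \<in> K \<Longrightarrow> b \<in> K \<Longrightarrow> a + b \<in> K"
    and "\<And>a b. a \<in> K \<Longrightarrow> b \<in> K \<Longrightarrow> a * b \<in> K"
    using subringE[OF K.subring_axioms] by (simp_all add: R_def)
  show "- a \<in> K" if "a \<in> K" for a
  proof -
    have "\<ominus>\<^bsub>?R\<^esub> a \<in> K"
      using subringE(5)[OF K.subring_axioms that] .
    moreover have "\<ominus>\<^bsub>?R\<^esub> a = - a"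
      by (rule R.minus_equality) (simp_all add: R_def)
    ultimately show ?thesis
      by simp
  qed
  show "inverse a \<in> K" if "a \<in> K" for a
  proof (cases "a = 0")
    case False
    then have "a \<in> Units (?R\<lparr>carrier := K\<rparr>)"
      using that K.subfield_Units by (simp add: R_def)
    then obtain b where "b \<in> K" "b * a = 1"
      by (auto simp: Units_def R_def)
    then show ?thesis
      by (metis inverse_unique mult.commute)
  \<comment> \<open>By convention \<open>inverse 0 = 0\<close>.\<close>
  qed (simp add: K0)
qed

lemma K_of_nat: "of_nat n \<in> K"
  by (induction n) (auto intro: K_0 K_1 K_add)

lemma K_numeral: "numeral n \<in> K"
  using K_of_nat[of "numeral n"] by simp

lemma K_diff: "a \<in> K \<Longrightarrow> b \<in> K \<Longrightarrow> a - b \<in> K"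
  using K_add[of a "- b"] K_uminus by simp

lemma K_divide: "a \<in> K \<Longrightarrow> b \<in> K \<Longrightarrow> a / b \<in> K"
  by (simp add: divide_inverse K_mult K_inverse)

lemma K_power: "a \<in> K \<Longrightarrow> a ^ n \<in> K"
  by (induction n) (auto intro: K_1 K_mult)


section \<open>Closure properties of the polynomials over \<open>K\<close>\<close>

abbreviation polys :: "'v set \<Rightarrow> 'v rpoly set" where
  "polys vs \<equiv> carrier (poly_ring_over K vs)"

lemma polys_iff:
  "p \<in> polys vs \<longleftrightarrow>
     (\<forall>m. Poly_Mapping.lookup p m \<in> K) \<and> (\<forall>m\<in>Poly_Mapping.keys p. Poly_Mapping.keys m \<subseteq> vs)"
  by (simp add: poly_ring_over_def)

lemma pconst_polys_iff: "pconst c \<in> polys vs \<longleftrightarrow> c \<in> K"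
  by (auto simp: polys_iff pconst_def lookup_single when_def K_0)

lemma pvar_polys: "v \<in> vs \<Longrightarrow> pvar v \<in> polys vs"
  by (auto simp: polys_iff pvar_def lookup_single when_def K_0 K_1)

lemma polys_add:
  assumes "p \<in> polys vs" "q \<in> polys vs"
  shows "p + q \<in> polys vs"
  unfolding polys_iff
proof (intro conjI allI ballI)
  show "Poly_Mapping.lookup (p + q) m \<in> K" for m
    using assms by (simp add: polys_iff lookup_add K_add)
  show "Poly_Mapping.keys m \<subseteq> vs" if "m \<in> Poly_Mapping.keys (p + q)" for m
    using assms subsetD[OF keys_add that] unfolding polys_iff by blast
qed

lemma polys_mult:
  assumes "p \<in> polys vs" "q \<in> polys vs"
  shows "p * q \<in> polys vs"
  unfolding polys_iff
proof safe
  show "Poly_Mapping.lookup (p * q) m \<in> K" for m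
    unfolding lookup_mult using assms
    by (auto simp: polys_iff when_def intro!: Sum_any_closed K_add K_mult K_0)
  fix m v
  assume "m \<in> Poly_Mapping.keys (p * q)" "v \<in> Poly_Mapping.keys m"
  moreover from this obtain k l where
    "m = k + l" "k \<in> Poly_Mapping.keys p" "l \<in> Poly_Mapping.keys q"
    using keys_mult[of p q] by blast
  ultimately show "v \<in> vs"
    using assms keys_add[of k l] unfolding polys_iff by blast
qed

text \<open>Regarding the subring as an ideal of itself makes the closure rules of
  \<open>subring_ideal\<close> available for it.\<close>

lemma subring_polys: "subring_ideal (polys vs) (polys vs)"
proof
  show "0 \<in> polys vs"
    using pconst_polys_iff[of 0] K_0 by simp
  show "1 \<in> polys vs"
    using pconst_polys_iff[of 1] K_1 by simp
  show "- p \<in> polys vs" if "p \<in> polys vs" for p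
    using that by (simp add: polys_iff K_uminus)
qed (simp_all add: polys_add polys_mult)

text \<open>The ring operations of \<open>poly_ring_over\<close> are the type-class ones, so the
  ideals over which \<open>genideal\<close> intersects fall under
  \<open>subring_ideal\<close>.\<close>

lemma subring_ideal_of_ideal:
  assumes "ideal I (poly_ring_over K vs)"
  shows "subring_ideal (polys vs) I"
proof -
  let ?R = "poly_ring_over K vs"
  interpret ideal I ?R
    by fact
  have R: "\<zero>\<^bsub>?R\<^esub> = 0" "\<one>\<^bsub>?R\<^esub> = 1" "(\<oplus>\<^bsub>?R\<^esub>) = (+)" "(\<otimes>\<^bsub>?R\<^esub>) = (*)"
    by (simp_all add: poly_ring_over_def ring_of_type_algebra_def)
  interpret polys: subring_ideal "polys vs" "polys vs"
    by (rule subring_polys)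
  show ?thesis
  proof
    show "I \<subseteq> polys vs"
      by (rule a_subset)
    show "0 \<in> I"
      using additive_subgroup.zero_closed[OF is_additive_subgroup] by (simp add: R)
    show "a + b \<in> I" if "a \<in> I" "b \<in> I" for a b
      using additive_subgroup.a_closed[OF is_additive_subgroup that] by (simp add: R)
    show "a * b \<in> I" if "a \<in> polys vs" "b \<in> I" for a b
      using I_l_closed[OF that(2,1)] by (simp add: R)
  qed (use polys.one_A polys.uminus_A polys_add polys_mult in auto)
qed

end

section \<open>Values modulo an ideal\<close>

text \<open>Congruence to a constant plays the part of evaluation at a point. It is a relation
  because values are not unique modulo an ideal containing 1.\<close>

definition has_value_mod :: "'v rpoly set \<Rightarrow> 'v rpoly \<Rightarrow> real \<Rightarrow> bool" where
  "has_value_mod J p c \<longleftrightarrow> p - pconst c \<in> J"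

locale poly_ideal = real_subfield K + subring_ideal "carrier (poly_ring_over K vs)" J
  for K and vs :: "'v set" and J
begin

abbreviation val :: "'v rpoly \<Rightarrow> real \<Rightarrow> bool" where
  "val p c \<equiv> p \<in> polys vs \<and> has_value_mod J p c"

lemma val_K:
  assumes "val p c"
  shows "c \<in> K"
proof -
  have "p - (p - pconst c) \<in> polys vs"
    using assms subset unfolding has_value_mod_def by (blast intro: diff_A)
  then show ?thesis
    by (simp add: pconst_polys_iff)
qed

lemma val_const: "c \<in> K \<Longrightarrow> val (pconst c) c"
  using zero by (simp add: has_value_mod_def pconst_polys_iff)

lemma val_1: "val 1 1"
  using val_const[OF K_1] by simp

lemma val_add: "val p c \<Longrightarrow> val q d \<Longrightarrow> val (p + q) (c + d)"
  using add[of "p - pconst c" "q - pconst d"] add_A[of p q]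
  by (simp add: has_value_mod_def pconst_add algebra_simps)

lemma val_diff: "val p c \<Longrightarrow> val q d \<Longrightarrow> val (p - q) (c - d)"
  using diff[of "p - pconst c" "q - pconst d"] diff_A[of p q]
  by (simp add: has_value_mod_def pconst_diff algebra_simps)

lemma val_mult:
  assumes "val p c" "val q d"
  shows "val (p * q) (c * d)"
proof -
  have "p * (q - pconst d) + pconst d * (p - pconst c) \<in> J"
    using assms val_K[of q d] by (intro add mult) (auto simp: has_value_mod_def pconst_polys_iff)
  then show ?thesis
    using assms mult_A by (simp add: has_value_mod_def pconst_mult algebra_simps)
qed

lemma val_power: "val p c \<Longrightarrow> val (p ^ k) (c ^ k)"
proof (induction k)
  case (Suc k)
  then show ?case
    using val_mult[of p c "p ^ k" "c ^ k"] by simp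
qed (use val_1 in simp)

lemma val_sum: "(\<And>i. i \<in> I \<Longrightarrow> val (f i) (g i)) \<Longrightarrow> val (sum f I) (sum g I)"
proof (induction I rule: infinite_finite_induct)
  case (insert i I)
  then show ?case
    using val_add[of "f i" "g i" "sum f I" "sum g I"] by simp
qed (use val_const[OF K_0] in simp_all)

lemma val_prod: "(\<And>i. i \<in> I \<Longrightarrow> val (f i) (g i)) \<Longrightarrow> val (prod f I) (prod g I)"
proof (induction I rule: infinite_finite_induct)
  case (insert i I)
  then show ?case
    using val_mult[of "f i" "g i" "prod f I" "prod g I"] by simp
qed (use val_1 in simp_all)

text \<open>A nonzero constant over \<open>K\<close> is invertible over \<open>K\<close>, so a
  proper ideal contains none. This turns each generator into an equation between values.\<close>

lemma val_in_ideal: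
  assumes "1 \<notin> J" "val p c" "p \<in> J"
  shows "c = 0"
proof (rule ccontr)
  assume c: "c \<noteq> 0"
  have "p - (p - pconst c) \<in> J"
    using assms unfolding has_value_mod_def by (blast intro: diff)
  then have "pconst (inverse c) * pconst c \<in> J"
    using assms val_K[of p c] by (intro mult) (auto simp: pconst_polys_iff K_inverse)
  with c assms(1) show False
    by (simp flip: pconst_mult)
qed

end

section \<open>Degrees\<close>

definition monom_degree :: "('v \<Rightarrow>\<^sub>0 nat) \<Rightarrow> nat" where
  "monom_degree m = (\<Sum>v\<in>Poly_Mapping.keys m. Poly_Mapping.lookup m v)"

lemma monom_degree_superset:
  assumes "finite V" "Poly_Mapping.keys m \<subseteq> V"
  shows "monom_degree m = (\<Sum>v\<in>V. Poly_Mapping.lookup m v)"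
  unfolding monom_degree_def using assms by (intro sum.mono_neutral_left) (auto simp: in_keys_iff)

lemma monom_degree_add: "monom_degree (m + m') = monom_degree m + monom_degree m'"
proof -
  let ?V = "Poly_Mapping.keys m \<union> Poly_Mapping.keys m'"
  have "monom_degree k = (\<Sum>v\<in>?V. Poly_Mapping.lookup k v)" if "Poly_Mapping.keys k \<subseteq> ?V" for k
    using that by (intro monom_degree_superset) auto
  then show ?thesis
    using keys_add[of m m'] by (simp add: lookup_add sum.distrib)
qed

lemma total_degree_le_iff:
  "total_degree p \<le> l \<longleftrightarrow> (\<forall>m\<in>Poly_Mapping.keys p. monom_degree m \<le> l)"
  by (simp add: total_degree_def monom_degree_def)

lemma total_degree_add_le:
  "total_degree p \<le> l \<Longrightarrow> total_degree q \<le> l \<Longrightarrow> total_degree (p + q) \<le> l"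
  unfolding total_degree_le_iff using keys_add[of p q] by blast

lemma total_degree_mult_le:
  "total_degree p \<le> k \<Longrightarrow> total_degree q \<le> l \<Longrightarrow> total_degree (p * q) \<le> k + l"
  unfolding total_degree_le_iff using keys_mult[of p q] by (fastforce simp: monom_degree_add add_mono)

lemma total_degree_pconst [simp]: "total_degree (pconst c) = 0"
proof -
  have "total_degree (pconst c) \<le> 0"
    unfolding total_degree_le_iff by (simp add: pconst_def monom_degree_def)
  then show ?thesis
    by simp
qed

lemma total_degree_pvar_le: "total_degree (pvar v) \<le> 1"
  by (simp add: total_degree_le_iff pvar_def monom_degree_def)

lemma total_degree_sum_le:
  "(\<And>i. i \<in> I \<Longrightarrow> total_degree (f i) \<le> l) \<Longrightarrow> total_degree (sum f I) \<le> l"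
  by (induction I rule: infinite_finite_induct)
    (auto intro!: total_degree_add_le simp: total_degree_le_iff[of 0])

lemma total_degree_prod_le:
  "(\<And>i. i \<in> I \<Longrightarrow> total_degree (f i) \<le> 1) \<Longrightarrow> total_degree (prod f I) \<le> card I"
proof (induction I rule: infinite_finite_induct)
  case (insert i I)
  then show ?case
    using total_degree_mult_le[of "f i" 1 "prod f I" "card I"] by simp
qed (use total_degree_pconst[of 1] in simp_all)

lemma total_degree_sigma_le: "total_degree (sigma VH i g) \<le> i"
  unfolding sigma_def
proof (rule total_degree_sum_le)
  show "total_degree (\<Prod>h\<in>S. pvar (VX g h)) \<le> i" if "S \<in> {S. S \<subseteq> VH \<and> card S = i}" for S
    using total_degree_prod_le[of S "\<lambda>h. pvar (VX g h)", OF total_degree_pvar_le] that by simp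
qed

lemma total_degree_s_viz_le: "total_degree (s_viz VH g) \<le> 3"
proof -
  have "total_degree (pconst c * sigma VH i g) \<le> 3" if "i \<le> 3" for c i
    using total_degree_mult_le[OF _ total_degree_sigma_le, of "pconst c" 0 VH i g] that by simp
  then show ?thesis
    unfolding s_viz_def Let_def by (intro total_degree_add_le) auto
qed

section \<open>The values of the certificate\<close>

text \<open>These closed forms reduce \<open>certificate_value\<close> to polynomial
  identities.\<close>

lemma real_binomials:
  "real (m choose 2) = real m * (real m - 1) / 2"
  "real (m choose 3) = real m * (real m - 1) * (real m - 2) / 6"
proof -
  show two: "real (m choose 2) = real m * (real m - 1) / 2" for m
    by (induction m) (simp_all add: numeral_eq_Suc field_simps)
  show "real (m choose 3) = real m * (real m - 1) * (real m - 2) / 6"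
  proof (induction m)
    case (Suc m)
    have "Suc m choose 3 = (m choose 2) + (m choose 3)"
      by (simp add: numeral_eq_Suc)
    then show ?case
      using Suc two[of m] by (simp add: field_simps)
  qed simp
qed

text \<open>The binomials up to order 3 span the cubics in \<open>m\<close>, so values at the four
  nodes \<open>n - 3\<close> to \<open>n\<close> determine the coefficients. The negative root at
  \<open>n - 1\<close> is one choice of sign, which squaring removes.\<close>

lemma certificate_value:
  assumes "n \<ge> 3" "m \<ge> n - 3" "m \<le> n"
  shows "(alpha0 (real n) + alpha1 (real n) * real m + alpha2 (real n) * real (m choose 2)
           + alpha3 * real (m choose 3))\<^sup>2 = real m - real (n - 3)" (is "?s\<^sup>2 = _")
proof -
  \<comment> \<open>This removes the truncated subtraction \<open>n - 3\<close>.\<close>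
  obtain k where n: "n = k + 3"
    using assms(1) by (metis le_add_diff_inverse2)
  define x where "x = real k"
  have rn: "real n = x + 3"
    by (simp add: n x_def)
  note defs = alpha0_def alpha1_def alpha2_def alpha3_def real_binomials rn
  note expand = algebra_simps add_divide_distrib diff_divide_distrib power2_eq_square power3_eq_cube
  consider "m = k" | "m = k + 1" | "m = k + 2" | "m = k + 3"
    using assms n by linarith
  then show ?thesis
  proof cases
    case 1
    then have m: "real m = x"
      by (simp add: x_def)
    have "?s = 0"
      unfolding defs m by (simp add: expand)
    then show ?thesis
      using 1 n by simp
  next
    case 2
    then have m: "real m = x + 1"
      by (simp add: x_def)
    have "?s = 1"
      unfolding defs m by (simp add: expand)
    then show ?thesis
      using 2 n by simp
  next
    case 3
    then have m: "real m = x + 2"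
      by (simp add: x_def)
    have "?s = - sqrt 2"
      unfolding defs m by (simp add: expand)
    then show ?thesis
      using 3 n by simp
  next
    case 4
    then have m: "real m = x + 3"
      by (simp add: x_def)
    have "?s = sqrt 3"
      unfolding defs m by (simp add: expand)
    then show ?thesis
      using 4 n by simp
  qed
qed

section \<open>Zeros of the Vizing ideal\<close>

text \<open>A row with fewer than \<open>k\<close> ones extends to a set \<open>S\<close> of size
  \<open>k - 1\<close>, and \<open>genH\<close> yields a vertex \<open>w\<close> outside
  \<open>S\<close> with no neighbour in \<open>S\<close>. As \<open>g\<close> has no edges,
  \<open>genX\<close> at \<open>(g, w)\<close> demands a neighbour of \<open>w\<close> in the row,
  hence in \<open>S\<close>: a contradiction.\<close>

lemma card_row_ge:
  fixes eG :: "'g set \<Rightarrow> real" and eH :: "'h set \<Rightarrow> real" and x :: "'g \<Rightarrow> 'h \<Rightarrow> real"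
  assumes "finite VG" "finite VH" "k \<ge> 1" "k \<le> card VH"
    and eG: "\<And>v w. v \<in> VG \<Longrightarrow> w \<in> VG \<Longrightarrow> v \<noteq> w \<Longrightarrow> eG {v, w} = 0 \<or> eG {v, w} = 1"
    and x: "\<And>g h. g \<in> VG \<Longrightarrow> h \<in> VH \<Longrightarrow> x g h = 0 \<or> x g h = 1"
    and genG: "\<And>S. S \<subseteq> VG \<Longrightarrow> card S + 1 = card VG \<Longrightarrow> (\<Prod>w\<in>VG - S. \<Sum>v\<in>S. eG {v, w}) = 0"
    and eH: "\<And>v w. v \<in> VH \<Longrightarrow> w \<in> VH \<Longrightarrow> v \<noteq> w \<Longrightarrow> eH {v, w} = 0 \<or> eH {v, w} = 1"
    and genH: "\<And>S. S \<subseteq> VH \<Longrightarrow> card S + 1 = k \<Longrightarrow> (\<Prod>w\<in>VH - S. \<Sum>v\<in>S. eH {v, w}) = 0"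
    and genX: "\<And>g h. g \<in> VG \<Longrightarrow> h \<in> VH \<Longrightarrow>
      (1 - x g h) * (\<Prod>g'\<in>VG - {g}. 1 - eG {g, g'} * x g' h) *
      (\<Prod>h'\<in>VH - {h}. 1 - eH {h, h'} * x g h') = 0"
    and g: "g \<in> VG"
  shows "k \<le> card {h\<in>VH. x g h = 1}"
proof (rule ccontr)
  let ?X = "{h\<in>VH. x g h = 1}"
  assume "\<not> k \<le> card ?X"
  \<comment> \<open>The row is padded because \<open>genH\<close> speaks only of sets of size
    exactly \<open>k - 1\<close>.\<close>
  then obtain S where S: "?X \<subseteq> S" "S \<subseteq> VH" "card S = k - 1"
    using exists_subset_between[of ?X "k - 1" VH] assms(2,4) by fastforce
  then obtain w where w: "w \<in> VH - S" "(\<Sum>v\<in>S. eH {v, w}) = 0"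
    using genH[OF S(2)] \<open>k \<ge> 1\<close> \<open>finite VH\<close> by (auto simp: prod_zero_iff)
  have "finite S"
    using S(2) \<open>finite VH\<close> finite_subset by blast
  moreover have nonneg: "0 \<le> eH {v, w}" if "v \<in> S" for v
    using eH[of v w] that S(2) w(1) by fastforce
  ultimately have noH: "eH {v, w} = 0" if "v \<in> S" for v
    using w(2) that by (subst (asm) sum_nonneg_eq_0_iff) auto
  \<comment> \<open>For \<open>S = VG - {g}\<close> the product in \<open>genG\<close> has the
    single factor belonging to \<open>g\<close>, a sum of nonnegative edge values at
    \<open>g\<close>.\<close>
  have noG: "eG {g, g'} = 0" if g': "g' \<in> VG - {g}" for g'
  proof -
    have "VG - (VG - {g}) = {g}" "card (VG - {g}) + 1 = card VG"
      using g \<open>finite VG\<close> card_Suc_Diff1[of VG g] by auto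
    with genG[of "VG - {g}"] have "(\<Sum>v\<in>VG - {g}. eG {v, g}) = 0"
      by simp
    moreover have "0 \<le> eG {v, g}" if "v \<in> VG - {g}" for v
      using eG[of v g] that g by fastforce
    ultimately have "eG {g', g} = 0"
      using g' \<open>finite VG\<close> by (subst (asm) sum_nonneg_eq_0_iff) auto
    then show ?thesis
      by (simp add: insert_commute)
  qed
  have "x g w \<noteq> 1"
    using S(1) w(1) by auto
  then have "x g w = 0"
    using x g w(1) by blast
  \<comment> \<open>The first two factors of \<open>genX\<close> equal 1 here.\<close>
  then have "(\<Prod>h'\<in>VH - {w}. 1 - eH {w, h'} * x g h') = 0"
    using genX[OF g, of w] w(1) noG by simp
  then obtain h' where h': "h' \<in> VH - {w}" "eH {w, h'} * x g h' = 1"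
    using \<open>finite VH\<close> by (auto simp: prod_zero_iff)
  then have "x g h' = 1"
    using x[OF g, of h'] by auto
  then have "h' \<in> S"
    using S(1) h'(1) by blast
  then show False
    using noH[of h'] h'(2) by (simp add: insert_commute)
qed

text \<open>A product of 0/1 values over \<open>S\<close> is 1 exactly when \<open>S\<close> lies in
  the support, so the sum counts the \<open>i\<close>-subsets of the support.\<close>

lemma sum_subset_prod_indicator:
  fixes x :: "'h \<Rightarrow> real"
  assumes "finite V" "\<And>h. h \<in> V \<Longrightarrow> x h = 0 \<or> x h = 1"
  shows "(\<Sum>S | S \<subseteq> V \<and> card S = i. \<Prod>h\<in>S. x h) = real (card {h\<in>V. x h = 1} choose i)"
proof -
  let ?X = "{h\<in>V. x h = 1}"
  have "(\<Sum>S | S \<subseteq> V \<and> card S = i. \<Prod>h\<in>S. x h) = (\<Sum>S | S \<subseteq> ?X \<and> card S = i. \<Prod>h\<in>S. x h)"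
  proof (intro sum.mono_neutral_right ballI)
    fix S assume S: "S \<in> {S. S \<subseteq> V \<and> card S = i} - {S. S \<subseteq> ?X \<and> card S = i}"
    then have "finite S"
      using assms(1) finite_subset by auto
    moreover have "\<exists>h\<in>S. x h = 0"
      using S assms(2) by blast
    ultimately show "(\<Prod>h\<in>S. x h) = 0"
      by (simp add: prod_zero_iff)
  qed (use assms(1) in auto)
  also have "\<dots> = (\<Sum>S | S \<subseteq> ?X \<and> card S = i. 1)"
    by (intro sum.cong refl prod.neutral) auto
  also have "\<dots> = real (card ?X choose i)"
    using n_subsets[of ?X i] assms(1) by simp
  finally show ?thesis .
qed

section \<open>Variables of the Vizing ring and their Boolean generators\<close>

lemma finite_viz_vars:
  assumes "finite VG" "finite VH"
  shows "finite (viz_vars VG VH)"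
proof -
  have "{VX g h | g h. g \<in> VG \<and> h \<in> VH} = (\<lambda>(g, h). VX g h) ` (VG \<times> VH)"
    by auto
  then show ?thesis
    using assms by (simp add: viz_vars_def)
qed

lemma boolean_gen:
  assumes "v \<in> viz_vars VG VH"
  shows "(pvar v)\<^sup>2 - pvar v \<in> viz_gens VG DG VH DH"
proof -
  consider p where "v = VEG p" "p \<subseteq> VG" "card p = 2" | p where "v = VEH p" "p \<subseteq> VH" "card p = 2"
    | g h where "v = VX g h" "g \<in> VG" "h \<in> VH"
    using assms unfolding viz_vars_def by blast
  then show ?thesis
  proof cases
    case 1
    then show ?thesis
      unfolding viz_gens_def graph_gens_def card_2_iff by blast
  next
    case 2
    then show ?thesis
      unfolding viz_gens_def graph_gens_def card_2_iff by blast
  next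
    case 3
    then show ?thesis
      unfolding viz_gens_def product_gens_def by blast
  qed
qed

lemma viz_vars_intros:
  "g \<in> VG \<Longrightarrow> g' \<in> VG \<Longrightarrow> g \<noteq> g' \<Longrightarrow> VEG {g, g'} \<in> viz_vars VG VH"
  "h \<in> VH \<Longrightarrow> h' \<in> VH \<Longrightarrow> h \<noteq> h' \<Longrightarrow> VEH {h, h'} \<in> viz_vars VG VH"
  "g \<in> VG \<Longrightarrow> h \<in> VH \<Longrightarrow> VX g h \<in> viz_vars VG VH"
  unfolding viz_vars_def by auto

section \<open>The certificate as polynomials over \<open>K\<close>\<close>

context real_subfield
begin

lemma alpha_in_K:
  assumes "sqrt 2 \<in> K" "sqrt 3 \<in> K"
  shows "n \<in> K \<Longrightarrow> alpha0 n \<in> K" "n \<in> K \<Longrightarrow> alpha1 n \<in> K" "n \<in> K \<Longrightarrow> alpha2 n \<in> K" "alpha3 \<in> K"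
  unfolding alpha0_def alpha1_def alpha2_def alpha3_def
  by (simp_all only: K_add K_diff K_mult K_divide K_uminus K_power K_1 K_numeral assms)

lemma s_viz_polys:
  assumes "sqrt 2 \<in> K" "sqrt 3 \<in> K" "g \<in> VG"
  shows "s_viz VH g \<in> polys (viz_vars VG VH)"
proof -
  interpret subring_ideal "polys (viz_vars VG VH)" "polys (viz_vars VG VH)"
    by (rule subring_polys)
  have "sigma VH i g \<in> polys (viz_vars VG VH)" for i
    unfolding sigma_def
  proof (intro sum_A prod_A pvar_polys viz_vars_intros(3) \<open>g \<in> VG\<close>)
    show "h \<in> VH" if "S \<in> {S. S \<subseteq> VH \<and> card S = i}" "h \<in> S" for S h
      using that by blast
  qed
  then show ?thesis
    unfolding s_viz_def Let_def
    by (intro add_A mult_A pconst_polys_iff[THEN iffD2] alpha_in_K K_of_nat assms)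
qed

text \<open>Supplies the side condition \<open>f \<in> A\<close> of
  \<open>boolean_ideal_memberI\<close> and settles the case of an ideal containing 1.\<close>

lemma difference_polys:
  assumes "sqrt 2 \<in> K" "sqrt 3 \<in> K"
  shows "f_viz VG DG VH DH - (\<Sum>g\<in>VG. (s_viz VH g)\<^sup>2) \<in> polys (viz_vars VG VH)"
proof -
  interpret subring_ideal "polys (viz_vars VG VH)" "polys (viz_vars VG VH)"
    by (rule subring_polys)
  show ?thesis
    unfolding f_viz_def power2_eq_square
    by (intro diff_A sum_A mult_A pvar_polys viz_vars_intros(3) pconst_polys_iff[THEN iffD2]
        K_of_nat s_viz_polys assms)
qed

end

text \<open>\<open>J\<close> assigns each variable the value 0 or 1, and hence gives every
  polynomial built from them a value. If \<open>J\<close> is proper, the generators vanish at this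
  point, \<open>card_row_ge\<close> bounds the rows, and the difference gets value 0.\<close>

lemma difference_in_boolean_ideal:
  fixes VG DG :: "'g set" and VH DH :: "'h set"
  assumes J: "poly_ideal K (viz_vars VG VH) J"
    and sqrts: "sqrt 2 \<in> K" "sqrt 3 \<in> K"
    and G: "finite VG" "DG = VG"
    and H: "finite VH" "card DH = card VH - 3" "card VH - 3 \<ge> 1"
    and gens: "viz_gens VG DG VH DH \<subseteq> J"
    and bool: "\<And>v. v \<in> viz_vars VG VH \<Longrightarrow> pvar v \<in> J \<or> pvar v - 1 \<in> J"
  shows "f_viz VG DG VH DH - (\<Sum>g\<in>VG. (s_viz VH g)\<^sup>2) \<in> J"
proof -
  interpret poly_ideal K "viz_vars VG VH" J
    by fact
  let ?vs = "viz_vars VG VH"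
  define n where "n = card VH"
  define k where "k = card VH - 3"
  \<comment> \<open>Both alternatives of \<open>bool\<close> can hold for one variable only if
    \<open>1 \<in> J\<close>; then 0 is chosen.\<close>
  define a where "a v = (if pvar v \<in> J then 0 else 1 :: real)" for v
  have a01: "a v = 0 \<or> a v = 1" for v
    by (simp add: a_def)
  have val_var: "val (pvar v) (a v)" if "v \<in> ?vs" for v
    using bool[OF that] that by (auto simp: a_def has_value_mod_def pvar_polys)
  note val_vars = val_var[OF viz_vars_intros(1)] val_var[OF viz_vars_intros(2)]
    val_var[OF viz_vars_intros(3)]
  define ones where "ones g = {h\<in>VH. a (VX g h) = 1}" for g
  have sum_ones: "(\<Sum>h\<in>VH. a (VX g h)) = real (card (ones g))" for g
  proof -
    have "(\<Sum>h\<in>VH. a (VX g h)) = (\<Sum>h\<in>VH. if a (VX g h) = 1 then 1 else 0)"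
      by (intro sum.cong) (use a01 in auto)
    then show ?thesis
      using H(1) by (simp add: ones_def sum.If_cases Int_def)
  qed
  define c where "c g = alpha0 (real n) + alpha1 (real n) * real (card (ones g))
    + alpha2 (real n) * real (card (ones g) choose 2) + alpha3 * real (card (ones g) choose 3)" for g
  have val_sigma: "val (sigma VH i g) (real (card (ones g) choose i))" if "g \<in> VG" for i g
  proof -
    have "val (sigma VH i g) (\<Sum>S | S \<subseteq> VH \<and> card S = i. \<Prod>h\<in>S. a (VX g h))"
      unfolding sigma_def using that by (intro val_sum val_prod val_vars) auto
    then show ?thesis
      using sum_subset_prod_indicator[of VH "\<lambda>h. a (VX g h)" i] a01 H(1) by (simp add: ones_def)
  qed
  have val_s: "val (s_viz VH g) (c g)" if "g \<in> VG" for g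
  proof -
    have "val (s_viz VH g)
      (alpha0 (real n) * real (card (ones g) choose 0) + alpha1 (real n) * real (card (ones g) choose 1)
       + alpha2 (real n) * real (card (ones g) choose 2) + alpha3 * real (card (ones g) choose 3))"
      unfolding s_viz_def Let_def n_def using that sqrts
      by (intro val_add val_mult val_const val_sigma alpha_in_K K_of_nat)
    then show ?thesis
      by (simp add: c_def)
  qed
  show ?thesis
  proof (cases "1 \<in> J")
    case True
    from mult[OF difference_polys[OF sqrts] True] show ?thesis
      by simp
  next
    case False
    \<comment> \<open>Each hypothesis of \<open>card_row_ge\<close> that equates a product to 0 is
      the value of one generator.\<close>
    have gen_0: "r = 0" if "p \<in> viz_gens VG DG VH DH" "val p r" for p r
      using val_in_ideal[OF False that(2)] that(1) gens by blast
    have row: "k \<le> card (ones g)" if "g \<in> VG" for g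
      unfolding ones_def
    proof (rule card_row_ge[where eG = "\<lambda>p. a (VEG p)" and eH = "\<lambda>p. a (VEH p)"])
      show "k \<ge> 1" "k \<le> card VH"
        using H(3) by (simp_all add: k_def)
      show "(\<Prod>w\<in>VG - S. \<Sum>v\<in>S. a (VEG {v, w})) = 0" if "S \<subseteq> VG" "card S + 1 = card VG" for S
      proof (rule gen_0)
        show "(\<Prod>w\<in>VG - S. \<Sum>v\<in>S. pvar (VEG {v, w})) \<in> viz_gens VG DG VH DH"
          unfolding viz_gens_def graph_gens_def using that G(2) by blast
      qed (use that in \<open>intro val_prod val_sum val_vars; auto\<close>)
      show "(\<Prod>w\<in>VH - S. \<Sum>v\<in>S. a (VEH {v, w})) = 0" if "S \<subseteq> VH" "card S + 1 = k" for S
      proof (rule gen_0)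
        show "(\<Prod>w\<in>VH - S. \<Sum>v\<in>S. pvar (VEH {v, w})) \<in> viz_gens VG DG VH DH"
          unfolding viz_gens_def graph_gens_def using that H(2) k_def by auto
      qed (use that in \<open>intro val_prod val_sum val_vars; auto\<close>)
      show "(1 - a (VX g h)) * (\<Prod>g'\<in>VG - {g}. 1 - a (VEG {g, g'}) * a (VX g' h)) *
          (\<Prod>h'\<in>VH - {h}. 1 - a (VEH {h, h'}) * a (VX g h')) = 0" if "g \<in> VG" "h \<in> VH" for g h
      proof (rule gen_0)
        show "(1 - pvar (VX g h)) * (\<Prod>g'\<in>VG - {g}. 1 - pvar (VEG {g, g'}) * pvar (VX g' h)) *
            (\<Prod>h'\<in>VH - {h}. 1 - pvar (VEH {h, h'}) * pvar (VX g h')) \<in> viz_gens VG DG VH DH"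
          unfolding viz_gens_def product_gens_def using that by blast
      qed (use that in \<open>intro val_mult val_prod val_diff val_1 val_vars; auto\<close>)
    qed (use G(1) H(1) a01 that in auto)
    have sq: "(c g)\<^sup>2 = real (card (ones g)) - real k" if "g \<in> VG" for g
      unfolding c_def k_def n_def
    proof (rule certificate_value)
      show "card (ones g) \<le> card VH"
        unfolding ones_def using H(1) by (intro card_mono) auto
    qed (use row[OF that] H(3) in \<open>simp_all add: k_def\<close>)
    have kk: "card DG * card DH = card VG * k"
      using G(2) H(2) by (simp add: k_def)
    have "val (f_viz VG DG VH DH - (\<Sum>g\<in>VG. (s_viz VH g)\<^sup>2))
      ((\<Sum>g\<in>VG. \<Sum>h\<in>VH. a (VX g h)) - real (card VG * k) - (\<Sum>g\<in>VG. (c g)\<^sup>2))"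
      unfolding f_viz_def kk
      by (intro val_diff val_sum val_power val_const val_s val_vars K_of_nat)
    moreover have "(\<Sum>g\<in>VG. \<Sum>h\<in>VH. a (VX g h)) - real (card VG * k) - (\<Sum>g\<in>VG. (c g)\<^sup>2) = 0"
      by (simp add: sum_ones sq sum_subtractf)
    ultimately show ?thesis
      by (simp add: has_value_mod_def)
  qed
qed

section \<open>Domination numbers\<close>

lemma domination_number_le:
  assumes "finite (pverts G)" "dominating_set G D"
  shows "domination_number G \<le> card D"
proof -
  have "finite {D. dominating_set G D}"
    using assms(1) by (rule rev_finite_subset[OF finite_Pow_iff[THEN iffD2]])
      (auto simp: dominating_set_def)
  then show ?thesis
    using assms(2) unfolding domination_number_def by (intro Min_le) auto
qed

lemma domination_number_attained:
  assumes "finite (pverts G)"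
  obtains D where "dominating_set G D" "card D = domination_number G"
proof -
  have "finite {D. dominating_set G D}"
    using assms by (rule rev_finite_subset[OF finite_Pow_iff[THEN iffD2]])
      (auto simp: dominating_set_def)
  moreover have "dominating_set G (pverts G)"
    by (simp add: dominating_set_def)
  ultimately have "domination_number G \<in> card ` {D. dominating_set G D}"
    unfolding domination_number_def by (intro Min_in) auto
  then show thesis
    using that by auto
qed

text \<open>If there were an arc from \<open>u\<close> to \<open>v\<close>, all vertices except
  \<open>v\<close> would form a smaller dominating set.\<close>

lemma no_arcs_if_domination_number_eq_card:
  assumes "pair_graph G" "domination_number G = card (pverts G)"
  shows "parcs G = {}"
proof (rule ccontr)
  interpret pair_graph G
    by fact
  assume "parcs G \<noteq> {}"
  then obtain u v where uv: "(u, v) \<in> parcs G"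
    by auto
  then have "u \<in> pverts G" "v \<in> pverts G" "u \<noteq> v"
    using arc_fst_in_verts[OF uv] arc_snd_in_verts[OF uv] pair_no_loops[OF uv] by auto
  then have "dominating_set G (pverts G - {v})"
    using uv by (auto simp: dominating_set_def)
  then have "card (pverts G) \<le> card (pverts G - {v})"
    using domination_number_le[of G] pair_finite_verts assms(2) by fastforce
  then show False
    using card_Diff1_less[OF pair_finite_verts \<open>v \<in> pverts G\<close>] by simp
qed

text \<open>Without arcs in \<open>G\<close>, a vertex \<open>(g, h)\<close> of the product has
  neighbours only in the copy of \<open>H\<close> at \<open>g\<close>. So each slice of a minimum
  dominating set dominates \<open>H\<close>, and the slice sizes add up to the size of the
  set.\<close>

lemma domination_number_product_ge:
  assumes "finite (pverts G)" "parcs G = {}" "finite (pverts H)"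
  shows "card (pverts G) * domination_number H \<le> domination_number (cartesian_product G H)"
proof -
  have verts: "pverts (cartesian_product G H) = pverts G \<times> pverts H"
    by (simp add: cartesian_product_def)
  obtain D where D: "dominating_set (cartesian_product G H) D"
    "card D = domination_number (cartesian_product G H)"
    using domination_number_attained[of "cartesian_product G H"] assms(1,3) by (auto simp: verts)
  define slice where "slice g = {h. (g, h) \<in> D}" for g
  have "D \<subseteq> pverts G \<times> pverts H"
    using D(1) by (simp add: dominating_set_def verts)
  then have D_eq: "D = Sigma (pverts G) slice" and slice_sub: "slice g \<subseteq> pverts H" for g
    by (auto simp: slice_def)
  have "dominating_set H (slice g)" if "g \<in> pverts G" for g
    unfolding dominating_set_def
  proof (intro conjI ballI slice_sub)
    fix h assume h: "h \<in> pverts H - slice g"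
    then have "(g, h) \<in> pverts (cartesian_product G H) - D"
      using that by (auto simp: verts slice_def)
    then obtain g' h' where "(g', h') \<in> D" "((g', h'), (g, h)) \<in> parcs (cartesian_product G H)"
      using D(1) unfolding dominating_set_def by fast
    then show "\<exists>h'\<in>slice g. (h', h) \<in> parcs H"
      using assms(2) by (auto simp: cartesian_product_def slice_def)
  qed
  then have "card (pverts G) * domination_number H \<le> (\<Sum>g\<in>pverts G. card (slice g))"
    using domination_number_le[OF assms(3)] sum_bounded_below[of "pverts G" "domination_number H"]
    by simp
  also have "\<dots> = card D"
    unfolding D_eq using assms(1,3) slice_sub finite_subset by (subst card_SigmaI) blast+
  finally show ?thesis
    using D(2) by simp
qed

section \<open>Assembling the certificate and the domination inequality\<close>

theorem theorem5p20:
  fixes K :: "real set"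
    and VG DG :: "'g set" and VH DH :: "'h set"
    and nG kG nH kH :: nat
  assumes K: "subfield K (ring_of_type_algebra :: real ring)" "sqrt 2 \<in> K" "sqrt 3 \<in> K"
    and G: "finite VG" "card VG = nG" "DG \<subseteq> VG" "card DG = kG"
    and H: "finite VH" "card VH = nH" "DH \<subseteq> VH" "card DH = kH"
    and kG: "kG = nG" "nG \<ge> 1"
    and kH: "kH = nH - 3" "nH - 3 \<ge> 1"
  shows "sos_certificate (viz_ring K VG VH) (viz_ideal K VG DG VH DH) 3 (f_viz VG DG VH DH)
           VG (s_viz VH) \<and>
         (\<forall>(G :: 'a pair_pre_digraph) (H :: 'b pair_pre_digraph).
            pair_graph G \<and> card (pverts G) = nG \<and> domination_number G = nG \<and>
            pair_graph H \<and> card (pverts H) = nH \<and> domination_number H = nH - 3 \<longrightarrow>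
            domination_number G * domination_number H
              \<le> domination_number (cartesian_product G H))"
proof (intro conjI allI impI)
  interpret real_subfield K
    by (rule real_subfield.intro) fact
  have DG: "DG = VG"
    using G kG(1) by (intro card_subset_eq) auto
  let ?f = "f_viz VG DG VH DH - (\<Sum>g\<in>VG. (s_viz VH g)\<^sup>2)"
  \<comment> \<open>The generated ideal is the intersection of all ideals containing the generators,
    so an arbitrary such \<open>I\<close> is treated.\<close>
  have "?f \<in> I" if I: "ideal I (viz_ring K VG VH)" and gens: "viz_gens VG DG VH DH \<subseteq> I" for I
  proof (rule boolean_ideal_memberI[where E = "pvar ` viz_vars VG VH"])
    show "subring_ideal (polys (viz_vars VG VH)) I"
      using I unfolding viz_ring_def by (rule subring_ideal_of_ideal)
    show "finite (pvar ` viz_vars VG VH)"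
      using finite_viz_vars[OF G(1) H(1)] by simp
    show "pvar ` viz_vars VG VH \<subseteq> polys (viz_vars VG VH)"
      by (intro image_subsetI pvar_polys)
    show "e\<^sup>2 - e \<in> I" if "e \<in> pvar ` viz_vars VG VH" for e
      using that gens by (auto dest: boolean_gen)
    show "?f \<in> polys (viz_vars VG VH)"
      using K by (intro difference_polys)
    show "?f \<in> J" if J: "subring_ideal (polys (viz_vars VG VH)) J" "I \<subseteq> J"
      and bool: "\<And>e. e \<in> pvar ` viz_vars VG VH \<Longrightarrow> e \<in> J \<or> e - 1 \<in> J" for J
    proof (rule difference_in_boolean_ideal)
      show "poly_ideal K (viz_vars VG VH) J"
        using real_subfield_axioms J(1) by (rule poly_ideal.intro)
    qed (use K G H kH DG gens J(2) bool in auto)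
  qed
  then have "?f \<in> viz_ideal K VG DG VH DH"
    unfolding viz_ideal_def genideal_def by blast
  then show "sos_certificate (viz_ring K VG VH) (viz_ideal K VG DG VH DH) 3
      (f_viz VG DG VH DH) VG (s_viz VH)"
    unfolding sos_certificate_def
    using G(1) by (simp add: viz_ring_def s_viz_polys[OF K(2,3)] total_degree_s_viz_le)
next
  fix G :: "'a pair_pre_digraph" and H :: "'b pair_pre_digraph"
  assume *: "pair_graph G \<and> card (pverts G) = nG \<and> domination_number G = nG \<and>
    pair_graph H \<and> card (pverts H) = nH \<and> domination_number H = nH - 3"
  then interpret G: pair_graph G + H: pair_graph H
    by auto
  have "parcs G = {}"
    using no_arcs_if_domination_number_eq_card[of G] * by simp
  with domination_number_product_ge[of G H] *
  show "domination_number G * domination_number H \<le> domination_number (cartesian_product G H)"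
    using G.pair_finite_verts H.pair_finite_verts by simp
qed

end
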